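(* Let $G=(V,E)$ be a finite graph (directed or undirected) with edge weights $w_{ij}\ge 0$ and internal opinions $s_i\in[0,1]$ for $i\in V$, and let $k$ be an integer with $0\le k\le |V|$. Then the greedy algorithm approximates the CAMPAIGN problem within factor $1-\frac1e$: if $T$ is a set of $k$ nodes output by the greedy algorithm, then $$g(\mathbf{z}\mid T)\ \ge\ \Bigl(1-\frac1e\Bigr)\max_{S\subseteq V,\ |S|=k} g(\mathbf{z}\mid S).$$
   Context: For an edge-weighted finite graph $G=(V,E)$ write $N(i)=\{j:(i,j)\in E\}$ (with $w_{ij}=w_{ji}$ if $G$ is undirected). For $T\subseteq V$, the equilibrium vector $\mathbf{z}=(z_i)_{i\in V}$ with the expressed opinions of the nodes in $T$ fixed to $1$ is the unique vector satisfying $$z_i=1 \text{ for } i\in T,\qquad z_i=\frac{s_i+\sum_{j\in N(i)}w_{ij}z_j}{1+\sum_{j\in N(i)}w_{ij}} \text{ for } i\in V\setminus T.$$ The overall opinion is $g(\mathbf{z}\mid T)=\sum_{i\in V}z_i$ for this equilibrium vector; the sum includes the nodes of $T$. The CAMPAIGN problem asks, given $G$, the weights, the internal opinions and $k$, for a set $T\subseteq V$ of $k$ nodes maximizing $g(\mathbf{z}\mid T)$. The greedy algorithm starts with $T^{(0)}=\emptyset$ and, for $t=1,\dots,k$, sets $T^{(t)}=T^{(t-1)}\cup\{i\}$, where $i\in V\setminus T^{(t-1)}$ is a node maximizing $g(\mathbf{z}\mid T^{(t-1)}\cup\{i\})$ (ties broken arbitrarily); it outputs $T=T^{(k)}$.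 Values of $g$ are assumed to be computed exactly. *)

theory Defs
  imports Complex_Main "HOL-Library.FuncSet" "Graph_Theory.Pair_Digraph"
begin

text \<open>
  A graph is a pair digraph (arcs are ordered pairs of vertices, loops allowed); an undirected
  graph is one with a symmetric arc set and \<open>w i j = w j i\<close>. Only the values of \<open>w\<close>
  on arcs and of \<open>s\<close> on vertices matter.
\<close>

definition nbrs :: "'a pair_pre_digraph \<Rightarrow> 'a \<Rightarrow> 'a set" where
  "nbrs G i = {j. (i, j) \<in> parcs G}"

text \<open>
  A vector indexed by the vertices is an extensional function, so that uniqueness is literal
  equality (lemma \<open>ex1_equilibrium\<close> below).
\<close>

definition is_equilibrium ::
    "'a pair_pre_digraph \<Rightarrow> ('a \<Rightarrow> 'a \<Rightarrow> real) \<Rightarrow> ('a \<Rightarrow> real) \<Rightarrow> 'a set \<Rightarrow> ('a \<Rightarrow> real) \<Rightarrow> bool" where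
  "is_equilibrium G w s T z \<longleftrightarrow>
     z \<in> extensional (pverts G) \<and>
     (\<forall>i\<in>T. z i = 1) \<and>
     (\<forall>i\<in>pverts G - T.
        z i = (s i + (\<Sum>j\<in>nbrs G i. w i j * z j)) / (1 + (\<Sum>j\<in>nbrs G i. w i j)))"

definition equilibrium ::
    "'a pair_pre_digraph \<Rightarrow> ('a \<Rightarrow> 'a \<Rightarrow> real) \<Rightarrow> ('a \<Rightarrow> real) \<Rightarrow> 'a set \<Rightarrow> 'a \<Rightarrow> real" where
  "equilibrium G w s T = (THE z. is_equilibrium G w s T z)"

definition overall_opinion ::
    "'a pair_pre_digraph \<Rightarrow> ('a \<Rightarrow> 'a \<Rightarrow> real) \<Rightarrow> ('a \<Rightarrow> real) \<Rightarrow> 'a set \<Rightarrow> real" where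
  "overall_opinion G w s T = (\<Sum>i\<in>pverts G. equilibrium G w s T i)"

text \<open>
  \<open>greedy_output G w s t T\<close>: the greedy algorithm can reach \<open>T\<close> after \<open>t\<close> steps under some
  way of breaking ties.
\<close>

inductive greedy_output ::
    "'a pair_pre_digraph \<Rightarrow> ('a \<Rightarrow> 'a \<Rightarrow> real) \<Rightarrow> ('a \<Rightarrow> real) \<Rightarrow> nat \<Rightarrow> 'a set \<Rightarrow> bool"
  for G w s where
  greedy_0: "greedy_output G w s 0 {}"
| greedy_Suc: "\<lbrakk>greedy_output G w s t T;
     is_arg_max (\<lambda>i. overall_opinion G w s (T \<union> {i})) (\<lambda>i. i \<in> pverts G - T) i\<rbrakk>
   \<Longrightarrow> greedy_output G w s (Suc t) (T \<union> {i})"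

lemma ex1_equilibrium:
  assumes "pair_fin_digraph G"
    and w: "\<And>i j. (i, j) \<in> parcs G \<Longrightarrow> 0 \<le> w i j"
    and s: "\<And>i. i \<in> pverts G \<Longrightarrow> 0 \<le> s i \<and> s i \<le> 1"
    and TV: "T \<subseteq> pverts G"
  shows "\<exists>!z. is_equilibrium G w s T z"
proof -
  interpret pair_fin_digraph G by fact
  have finV: "finite (pverts G)" by simp
  have nV: "j \<in> pverts G" if "j \<in> nbrs G i" for i j
    using that in_arcsD2 by (auto simp: nbrs_def)
  have wn: "0 \<le> w i j" if "j \<in> nbrs G i" for i j
    using that w by (auto simp: nbrs_def)
  define W where "W i = (\<Sum>j\<in>nbrs G i. w i j)" for i
  have W0: "0 \<le> W i" for i unfolding W_def by (intro sum_nonneg wn)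
  define F where "F z = (\<lambda>i\<in>pverts G. if i \<in> T then 1
      else (s i + (\<Sum>j\<in>nbrs G i. w i j * z j)) / (1 + W i))" for z :: "'a \<Rightarrow> real"
  have eq_iff: "is_equilibrium G w s T z \<longleftrightarrow> z = F z" for z
  proof
    assume z: "is_equilibrium G w s T z"
    show "z = F z"
      using z TV by (auto simp: is_equilibrium_def F_def W_def extensional_def fun_eq_iff)
  next
    assume zF: "z = F z"
    have "F z i = 1" if "i \<in> T" for i using that TV by (auto simp: F_def)
    moreover have "F z i = (s i + (\<Sum>j\<in>nbrs G i. w i j * z j)) / (1 + W i)"
      if "i \<in> pverts G - T" for i using that by (auto simp: F_def)
    moreover have "F z \<in> extensional (pverts G)" by (simp add: F_def)
    ultimately show "is_equilibrium G w s T z"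
      unfolding is_equilibrium_def W_def[symmetric] using zF by metis
  qed
  have mono: "F x i \<le> F y i"
    if "\<And>j. j \<in> pverts G \<Longrightarrow> x j \<le> y j" "i \<in> pverts G" for x y i
  proof -
    have "(\<Sum>j\<in>nbrs G i. w i j * x j) \<le> (\<Sum>j\<in>nbrs G i. w i j * y j)"
      by (intro sum_mono mult_left_mono wn that nV)
    then show ?thesis using W0[of i] that(2) by (auto simp: F_def intro!: divide_right_mono)
  qed
  define Z where "Z n = (F ^^ n) (\<lambda>i. 0)" for n
  have Z_Suc: "Z (Suc n) = F (Z n)" for n by (simp add: Z_def)
  have F0: "0 \<le> F (\<lambda>i. 0) i" if "i \<in> pverts G" for i
    using that s[of i] W0[of i] by (auto simp: F_def)
  have F1: "F (\<lambda>i. 1) i \<le> 1" if "i \<in> pverts G" for i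
    using that s[of i] W0[of i] by (auto simp: F_def W_def[symmetric] divide_le_eq)
  have inc: "i \<in> pverts G \<Longrightarrow> Z n i \<le> Z (Suc n) i" for n i
  proof (induction n arbitrary: i)
    case 0 then show ?case using F0 by (simp add: Z_def)
  next
    case (Suc n) show ?case
      unfolding Z_Suc by (rule mono) (use Suc in \<open>auto simp: Z_Suc[symmetric]\<close>)
  qed
  have le1: "i \<in> pverts G \<Longrightarrow> Z n i \<le> 1" for n i
  proof (induction n arbitrary: i)
    case 0 then show ?case by (simp add: Z_def)
  next
    case (Suc n)
    have "F (Z n) i \<le> F (\<lambda>i. 1) i" by (rule mono) (use Suc in auto)
    with F1[OF Suc.prems] show ?case by (simp add: Z_Suc)
  qed
  have "\<exists>l. (\<lambda>n. Z n i) \<longlonglongrightarrow> l" if i: "i \<in> pverts G" for i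
  proof -
    have "incseq (\<lambda>n. Z n i)" using inc[OF i] by (rule incseq_SucI)
    then show ?thesis using incseq_convergent[of "\<lambda>n. Z n i" 1] le1[OF i] by blast
  qed
  then obtain l where l: "(\<lambda>n. Z n i) \<longlonglongrightarrow> l i" if "i \<in> pverts G" for i
    by metis
  define z where "z = restrict l (pverts G)"
  have zl: "(\<lambda>n. Z n i) \<longlonglongrightarrow> z i" if "i \<in> pverts G" for i
    using l that by (simp add: z_def)
  have "z i = F z i" for i
  proof (cases "i \<in> pverts G")
    case True
    have "(\<lambda>n. \<Sum>j\<in>nbrs G i. w i j * Z n j) \<longlonglongrightarrow> (\<Sum>j\<in>nbrs G i. w i j * z j)"
      by (intro tendsto_sum tendsto_mult tendsto_const zl nV)
    then have "(\<lambda>n. (s i + (\<Sum>j\<in>nbrs G i. w i j * Z n j)) / (1 + W i))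
        \<longlonglongrightarrow> (s i + (\<Sum>j\<in>nbrs G i. w i j * z j)) / (1 + W i)"
      using W0[of i] by (intro tendsto_divide tendsto_add tendsto_const) auto
    then have "(\<lambda>n. F (Z n) i) \<longlonglongrightarrow> F z i" using True by (simp add: F_def)
    moreover have "(\<lambda>n. F (Z n) i) \<longlonglongrightarrow> z i"
      using LIMSEQ_Suc[OF zl[OF True]] by (simp add: Z_Suc)
    ultimately show ?thesis using LIMSEQ_unique by blast
  qed (simp add: F_def z_def)
  then have ex: "z = F z" by blast
  have le: "x i \<le> y i" if x: "x = F x" and y: "y = F y" and i: "i \<in> pverts G" for x y i
  proof (rule ccontr)
    assume neg: "\<not> x i \<le> y i"
    define M where "M = Max ((\<lambda>j. x j - y j) ` pverts G)"
    have M: "x j - y j \<le> M" if "j \<in> pverts G" for j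
      unfolding M_def using finV that by (intro Max_ge) auto
    have M0: "0 < M" using neg M[OF i] by simp
    have "M \<in> (\<lambda>j. x j - y j) ` pverts G"
      unfolding M_def using finV i by (intro Max_in) auto
    then obtain m where m: "m \<in> pverts G" "x m - y m = M" by auto
    have mT: "m \<notin> T"
    proof
      assume "m \<in> T"
      then have "F x m = 1" "F y m = 1" using m(1) by (auto simp: F_def)
      with x y have "x m = 1" "y m = 1" by metis+
      with m M0 show False by simp
    qed
    have "F x m = (s m + (\<Sum>j\<in>nbrs G m. w m j * x j)) / (1 + W m)"
         "F y m = (s m + (\<Sum>j\<in>nbrs G m. w m j * y j)) / (1 + W m)"
      using m(1) mT by (auto simp: F_def)
    then have "x m = (s m + (\<Sum>j\<in>nbrs G m. w m j * x j)) / (1 + W m)"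
         "y m = (s m + (\<Sum>j\<in>nbrs G m. w m j * y j)) / (1 + W m)"
      using x y by metis+
    then have "x m * (1 + W m) = s m + (\<Sum>j\<in>nbrs G m. w m j * x j)"
              "y m * (1 + W m) = s m + (\<Sum>j\<in>nbrs G m. w m j * y j)"
      using W0[of m] by (simp_all add: nonzero_eq_divide_eq)
    then have "M * (1 + W m) = (\<Sum>j\<in>nbrs G m. w m j * (x j - y j))"
      unfolding m(2)[symmetric] by (simp add: algebra_simps sum_subtractf)
    also have "\<dots> \<le> (\<Sum>j\<in>nbrs G m. w m j * M)"
      by (intro sum_mono mult_left_mono wn M nV)
    also have "\<dots> = M * W m" by (simp add: W_def sum_distrib_left mult.commute)
    finally show False using M0 by (simp add: algebra_simps)
  qed
  have "x = y" if x: "x = F x" and y: "y = F y" for x y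
  proof
    fix i show "x i = y i"
    proof (cases "i \<in> pverts G")
      case True then show ?thesis using le[OF x y] le[OF y x] by (meson order_antisym)
    next
      case False
      then have "F x i = F y i" by (simp add: F_def)
      with x y show ?thesis by metis
    qed
  qed
  with ex show ?thesis unfolding eq_iff by blast
qed

end

(* A maximum principle for the operator z i * (1 + W i) - (\<Sum>j. w i j * z j) makes the equilibrium
   vector pointwise monotone in T, and, applied to the difference of two increments, pointwise
   submodular. Hence the overall opinion is a nonnegative monotone submodular set function, and the
   argument of Nemhauser, Wolsey and Fisher applies: a greedy step closes at least a 1/k fraction of
   the gap to the optimum, so after k steps a gap of at most (1 - 1/k)^k \<le> 1/e times the optimum
   remains. *)

theory Submission
  imports Defs
begin

locale opinion_graph = pair_fin_digraph G
  for G :: "'a pair_pre_digraph" +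
  fixes w :: "'a \<Rightarrow> 'a \<Rightarrow> real" and s :: "'a \<Rightarrow> real"
  assumes weight_nonneg: "(i, j) \<in> parcs G \<Longrightarrow> 0 \<le> w i j"
    and internal_bounds: "i \<in> pverts G \<Longrightarrow> 0 \<le> s i \<and> s i \<le> 1"
begin

abbreviation "V \<equiv> pverts G"
abbreviation "N \<equiv> nbrs G"
abbreviation "W i \<equiv> \<Sum>j\<in>N i. w i j"
abbreviation "z \<equiv> equilibrium G w s"
abbreviation "g \<equiv> overall_opinion G w s"

lemma weight_sum_nonneg: "0 \<le> W i"
  by (intro sum_nonneg) (simp add: nbrs_def weight_nonneg)

text \<open>At a vertex \<open>m\<close> where \<open>d\<close> is largest and positive, the
  weighted sum is at most \<open>d m * W m\<close>, while the hypothesis bounds it below by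
  \<open>d m * (1 + W m)\<close>; the summand 1 gives the contradiction. The alternative
  \<open>d i \<le> 0\<close> is meant for vertices with fixed opinion, where no equation
  holds.\<close>

lemma maximum_principle:
  assumes d: "\<And>i. i \<in> V \<Longrightarrow> d i \<le> 0 \<or> d i * (1 + W i) \<le> (\<Sum>j\<in>N i. w i j * d j)"
    and "i \<in> V"
  shows "d i \<le> 0"
proof (rule ccontr)
  assume "\<not> d i \<le> 0"
  obtain m where m: "m \<in> V" and max: "\<And>j. j \<in> V \<Longrightarrow> d j \<le> d m"
  proof -
    have "Max (d ` V) \<in> d ` V"
      using \<open>i \<in> V\<close> by (intro Max_in) auto
    then obtain m where "m \<in> V" "d m = Max (d ` V)"
      by auto
    then show ?thesis
      using that[of m] by simp
  qed
  have pos: "0 < d m"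
    using max[OF \<open>i \<in> V\<close>] \<open>\<not> d i \<le> 0\<close> by simp
  with d[OF m] have "d m * (1 + W m) \<le> (\<Sum>j\<in>N m. w m j * d j)"
    by simp
  also have "\<dots> \<le> (\<Sum>j\<in>N m. w m j * d m)"
    by (intro sum_mono mult_left_mono max weight_nonneg)
      (auto simp: nbrs_def dest: in_arcsD2)
  also have "\<dots> = d m * W m"
    by (simp add: sum_distrib_left mult.commute)
  finally show False
    using pos by (simp add: algebra_simps)
qed

lemma is_equilibrium_equilibrium:
  assumes "T \<subseteq> V"
  shows "is_equilibrium G w s T (z T)"
  unfolding equilibrium_def
  using ex1_equilibrium[OF pair_fin_digraph_axioms weight_nonneg internal_bounds assms]
  by (rule theI')

lemma equilibrium_fixed: "T \<subseteq> V \<Longrightarrow> i \<in> T \<Longrightarrow> z T i = 1"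
  using is_equilibrium_equilibrium by (simp add: is_equilibrium_def)

text \<open>Clearing the positive denominator makes the condition linear, so that differences of
  equilibria can be fed to \<open>maximum_principle\<close>.\<close>

lemma equilibrium_free:
  assumes "T \<subseteq> V" "i \<in> V" "i \<notin> T"
  shows "z T i * (1 + W i) = s i + (\<Sum>j\<in>N i. w i j * z T j)"
proof -
  have "z T i = (s i + (\<Sum>j\<in>N i. w i j * z T j)) / (1 + W i)"
    using is_equilibrium_equilibrium assms by (simp add: is_equilibrium_def)
  then show ?thesis
    using weight_sum_nonneg[of i] by (simp add: nonzero_eq_divide_eq)
qed

lemma equilibrium_nonneg:
  assumes "T \<subseteq> V" "i \<in> V"
  shows "0 \<le> z T i"
proof -
  have "- z T i \<le> 0"
  proof (rule maximum_principle[OF _ \<open>i \<in> V\<close>])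
    fix i assume i: "i \<in> V"
    \<comment> \<open>At a free vertex the two sides of the second alternative differ exactly by
      \<open>s i\<close>, which is nonnegative.\<close>
    show "- z T i \<le> 0 \<or> - z T i * (1 + W i) \<le> (\<Sum>j\<in>N i. w i j * - z T j)"
      using equilibrium_fixed[OF assms(1), of i] equilibrium_free[OF assms(1) i]
        internal_bounds[OF i]
      by (cases "i \<in> T") (simp_all add: sum_negf)
  qed
  then show ?thesis by simp
qed

lemma equilibrium_le_1:
  assumes "T \<subseteq> V" "i \<in> V"
  shows "z T i \<le> 1"
proof -
  have "z T i - 1 \<le> 0"
  proof (rule maximum_principle[OF _ \<open>i \<in> V\<close>])
    fix i assume i: "i \<in> V"
    \<comment> \<open>At a free vertex the two sides of the second alternative differ by
      \<open>1 - s i\<close>, because the constant vector 1 would solve the equation with internal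
      opinion 1.\<close>
    show "z T i - 1 \<le> 0 \<or> (z T i - 1) * (1 + W i) \<le> (\<Sum>j\<in>N i. w i j * (z T j - 1))"
      using equilibrium_fixed[OF assms(1), of i] equilibrium_free[OF assms(1) i]
        internal_bounds[OF i]
      by (cases "i \<in> T") (simp_all add: right_diff_distrib left_diff_distrib sum_subtractf)
  qed
  then show ?thesis by simp
qed

text \<open>On \<open>T\<close> the larger equilibrium has the top value 1. Off \<open>T\<close>
  both vectors obey the same equation, so \<open>s i\<close> cancels and the difference satisfies
  the maximum principle with equality.\<close>

lemma equilibrium_mono:
  assumes "S \<subseteq> T" "T \<subseteq> V" "i \<in> V"
  shows "z S i \<le> z T i"
proof -
  have S: "S \<subseteq> V" using assms by blast
  have "z S i - z T i \<le> 0"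
  proof (rule maximum_principle[OF _ \<open>i \<in> V\<close>])
    fix i assume i: "i \<in> V"
    show "z S i - z T i \<le> 0 \<or>
        (z S i - z T i) * (1 + W i) \<le> (\<Sum>j\<in>N i. w i j * (z S j - z T j))"
    proof (cases "i \<in> T")
      case True
      then show ?thesis
        using equilibrium_le_1[OF S i] equilibrium_fixed[OF assms(2)] by simp
    next
      case False
      with \<open>S \<subseteq> T\<close> have "i \<notin> S" by blast
      then show ?thesis
        using equilibrium_free[OF S i] equilibrium_free[OF assms(2) i False]
        by (simp add: right_diff_distrib left_diff_distrib sum_subtractf)
    qed
  qed
  then show ?thesis by simp
qed

text \<open>The maximum principle is applied to the second difference \<open>?d\<close>. Outside
  \<open>insert a T\<close> all four equilibria are free, and the \<open>s i\<close> cancel in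
  pairs.\<close>

lemma equilibrium_submodular:
  assumes "S \<subseteq> T" "T \<subseteq> V" "a \<in> V" "i \<in> V"
  shows "z (insert a T) i - z T i \<le> z (insert a S) i - z S i"
proof -
  have sub: "S \<subseteq> V" "insert a S \<subseteq> V" "insert a T \<subseteq> V" using assms by auto
  have "(z (insert a T) i - z T i) - (z (insert a S) i - z S i) \<le> 0" (is "?d i \<le> 0")
  proof (rule maximum_principle[OF _ \<open>i \<in> V\<close>])
    fix i assume i: "i \<in> V"
    show "?d i \<le> 0 \<or> ?d i * (1 + W i) \<le> (\<Sum>j\<in>N i. w i j * ?d j)"
    proof (cases "i \<in> insert a T")
      case True
      then consider "i \<in> T" | "i = a" by blast
      then have "?d i \<le> 0"
      proof cases
        \<comment> \<open>The increment over \<open>T\<close> vanishes here, and the one over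
          \<open>S\<close> is nonnegative by monotonicity.\<close>
        case 1
        then have "z T i = 1" "z (insert a T) i = 1"
          using equilibrium_fixed \<open>T \<subseteq> V\<close> sub by auto
        then show ?thesis
          using equilibrium_mono[OF subset_insertI[of S a] sub(2) i] by simp
      next
        \<comment> \<open>Both enlarged equilibria equal 1 at \<open>a\<close>, so the claim reduces
          to \<open>z S a \<le> z T a\<close>.\<close>
        case 2
        then have "z (insert a S) i = 1" "z (insert a T) i = 1"
          using equilibrium_fixed sub by auto
        then show ?thesis
          using equilibrium_mono[OF \<open>S \<subseteq> T\<close> \<open>T \<subseteq> V\<close> i] by simp
      qed
      then show ?thesis ..
    next
      case False
      with \<open>S \<subseteq> T\<close> have "i \<notin> T" "i \<notin> S" "i \<notin> insert a S" by auto
      then show ?thesis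
        using equilibrium_free[OF \<open>T \<subseteq> V\<close> i] equilibrium_free[OF sub(1) i]
          equilibrium_free[OF sub(2) i] equilibrium_free[OF sub(3) i False]
        by (simp add: right_diff_distrib left_diff_distrib sum_subtractf)
    qed
  qed
  then show ?thesis by simp
qed

lemma overall_opinion_nonneg: "T \<subseteq> V \<Longrightarrow> 0 \<le> g T"
  unfolding overall_opinion_def by (intro sum_nonneg equilibrium_nonneg)

lemma overall_opinion_mono: "S \<subseteq> T \<Longrightarrow> T \<subseteq> V \<Longrightarrow> g S \<le> g T"
  unfolding overall_opinion_def by (intro sum_mono equilibrium_mono)

lemma overall_opinion_submodular:
  assumes "S \<subseteq> T" "T \<subseteq> V" "a \<in> V"
  shows "g (insert a T) - g T \<le> g (insert a S) - g S"
  unfolding overall_opinion_def sum_subtractf[symmetric]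
  by (intro sum_mono equilibrium_submodular assms)

text \<open>The elements of \<open>S\<close> are added to \<open>T\<close> one at a time; by
  submodularity each gains at most what it would gain over \<open>T\<close> alone.\<close>

lemma overall_opinion_union_le:
  assumes "T \<subseteq> V" "S \<subseteq> V"
  shows "g (T \<union> S) - g T \<le> (\<Sum>a\<in>S. g (insert a T) - g T)"
proof -
  have "finite S" using \<open>S \<subseteq> V\<close> by (rule finite_subset) simp
  then show ?thesis using \<open>S \<subseteq> V\<close>
  proof (induction S rule: finite_induct)
    case (insert a S)
    then have "g (insert a (T \<union> S)) - g (T \<union> S) \<le> g (insert a T) - g T"
      using \<open>T \<subseteq> V\<close> by (intro overall_opinion_submodular) auto
    with insert show ?case by simp
  qed simp
qed

lemma greedy_output_subset: "greedy_output G w s t T \<Longrightarrow> T \<subseteq> V"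
  by (induction rule: greedy_output.induct) (auto simp: is_arg_max_def)

lemma greedy_step_gap:
  assumes T: "T \<subseteq> V" and S: "S \<subseteq> V"
    and i: "is_arg_max (\<lambda>i. g (T \<union> {i})) (\<lambda>i. i \<in> V - T) i"
  shows "g S - g T \<le> real (card S) * (g (T \<union> {i}) - g T)"
proof -
  have iV: "T \<union> {i} \<subseteq> V" using T i by (auto simp: is_arg_max_def)
  \<comment> \<open>Elements of \<open>T\<close> are not candidates of the greedy choice, but adding
    them gains nothing, so monotonicity covers them.\<close>
  have le: "g (insert a T) \<le> g (T \<union> {i})" if "a \<in> S" for a
  proof (cases "a \<in> T")
    case True
    then show ?thesis
      using overall_opinion_mono[OF Un_upper1 iV] by (simp add: insert_absorb)
  next
    case False
    then show ?thesis
      using i S \<open>a \<in> S\<close> by (auto simp: is_arg_max_linorder)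
  qed
  have "g S \<le> g (T \<union> S)"
    using T S by (intro overall_opinion_mono) auto
  then have "g S - g T \<le> (\<Sum>a\<in>S. g (insert a T) - g T)"
    using overall_opinion_union_le[OF T S] by linarith
  also have "\<dots> \<le> (\<Sum>a\<in>S. g (T \<union> {i}) - g T)"
    by (intro sum_mono diff_right_mono le)
  finally show ?thesis by simp
qed

text \<open>Each step multiplies the gap by at most \<open>1 - 1 / card S\<close>. The initial gap
  is at most \<open>g S\<close> because \<open>g {}\<close> is nonnegative.\<close>

lemma greedy_gap:
  assumes "greedy_output G w s t T" "S \<subseteq> V" "0 < card S"
  shows "g S - g T \<le> (1 - 1 / card S) ^ t * g S"
  using assms(1)
proof (induction rule: greedy_output.induct)
  case greedy_0
  show ?case using overall_opinion_nonneg[of "{}"] by simp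
next
  case (greedy_Suc t T i)
  let ?c = "real (card S)"
  have "(g S - g T) / ?c \<le> g (T \<union> {i}) - g T"
    using greedy_step_gap[OF greedy_output_subset[OF greedy_Suc.hyps(1)] assms(2)
        greedy_Suc.hyps(2)] \<open>0 < card S\<close>
    by (simp add: pos_divide_le_eq mult.commute)
  then have "g S - g (T \<union> {i}) \<le> (1 - 1 / ?c) * (g S - g T)"
    by (simp add: left_diff_distrib diff_divide_distrib)
  \<comment> \<open>The factor is nonnegative since \<open>card S\<close> is at least 1, so the
    induction hypothesis may be multiplied by it.\<close>
  also have "\<dots> \<le> (1 - 1 / ?c) * ((1 - 1 / ?c) ^ t * g S)"
    using \<open>0 < card S\<close> by (intro mult_left_mono greedy_Suc.IH) simp
  finally show ?case by (simp add: mult.assoc)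
qed

lemma greedy_approximation:
  assumes "greedy_output G w s (card S) T" "S \<subseteq> V"
  shows "(1 - 1 / exp 1) * g S \<le> g T"
proof (cases "card S = 0")
  \<comment> \<open>With no steps there is no contraction factor to use; both sets are empty and
    \<open>g {}\<close> is nonnegative.\<close>
  case True
  then have "S = {}"
    using finite_subset[OF \<open>S \<subseteq> V\<close>] by simp
  moreover have "T = {}"
    using assms(1) unfolding True by cases
  moreover have "(1 - 1 / exp 1) * g {} \<le> 1 * g {}"
    by (intro mult_right_mono overall_opinion_nonneg) auto
  ultimately show ?thesis by simp
next
  case False
  then have pos: "0 < card S" by simp
  have "(1 - 1 / card S) ^ card S \<le> exp (- 1)"
    using exp_ge_one_minus_x_over_n_power_n[of 1 "card S"] pos by simp
  then have "(1 - 1 / card S) ^ card S * g S \<le> 1 / exp 1 * g S"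
    by (intro mult_right_mono overall_opinion_nonneg assms(2)) (simp add: exp_minus field_simps)
  with greedy_gap[OF assms pos] show ?thesis
    by (simp add: left_diff_distrib)
qed

end

theorem mainTheorem3:
  fixes G :: "'a pair_pre_digraph"
    and w :: "'a \<Rightarrow> 'a \<Rightarrow> real"
    and s :: "'a \<Rightarrow> real"
    and k :: nat
    and T :: "'a set"
  assumes "pair_fin_digraph G"
    and "\<And>i j. (i, j) \<in> parcs G \<Longrightarrow> 0 \<le> w i j"
    and "\<And>i. i \<in> pverts G \<Longrightarrow> 0 \<le> s i \<and> s i \<le> 1"
    and "k \<le> card (pverts G)"
    and "greedy_output G w s k T"
  shows "overall_opinion G w s T \<ge>
    (1 - 1 / exp 1) * Max (overall_opinion G w s ` {S. S \<subseteq> pverts G \<and> card S = k})"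
proof -
  interpret pair_fin_digraph G by fact
  interpret opinion_graph G w s
    by unfold_locales (use assms in auto)
  let ?A = "{S. S \<subseteq> V \<and> card S = k}"
  \<comment> \<open>Since \<open>k\<close> is at most the number of vertices, the family is
    nonempty; being finite as well, it attains the maximum at some \<open>S\<close>.\<close>
  have "?A \<noteq> {}"
    using obtain_subset_with_card_n[OF assms(4)] by blast
  moreover have "finite ?A"
    by (rule finite_subset[of _ "Pow V"]) auto
  ultimately have "Max (g ` ?A) \<in> g ` ?A"
    by (intro Max_in) auto
  then obtain S where "S \<subseteq> V" "card S = k" "Max (g ` ?A) = g S"
    by auto
  then show ?thesis
    using greedy_approximation assms(5) by simp
qed

end
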